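(* Let $X$ be a compact Hausdorff space equipped with a continuous action $\alpha$ of a semigroup $S$. Suppose that the dynamical system $(X,S,\alpha)$ is expansive and has the pseudo-orbit tracing property. Then $(X,S,\alpha)$ is topologically semistable. Moreover, if $E$ is an expansivity entourage for $(X,S,\alpha)$, then the following holds: there exists a neighborhood $N$ of $\alpha$ in $\mathrm{CSA}_S(X)$ such that if $\beta\in N$ is $E$-expansive then there exists an injective continuous map $h\colon X\to X$ satisfying $\alpha_s\circ h=h\circ\beta_s$ for all $s\in S$.
   Context: A continuous action of a semigroup $S$ on a topological space $X$ is a family of continuous maps $\alpha_s\colon X\to X$ ($s\in S$), written also $sx=\alpha_s(x)$, with $\alpha_s\circ\alpha_{s'}=\alpha_{ss'}$ for all $s,s'\in S$. A compact Hausdorff space $X$ carries a unique uniform structure inducing its topology; its entourages are the neighborhoods of the diagonal in $X\times X$. $E$-expansive: an entourage $E$ of $X$ is an expansivity entourage for $(X,S,\alpha)$, or $\alpha$ (or $(X,S,\alpha)$) is $E$-expansive, if for all distinct $x,y\in X$ there exists $s\in S$ with $(\alpha_s(x),\alpha_s(y))\notin E$. The system is expansive if it is $E$-expansive for some entourage $E$. Pseudo-orbit tracing property: for a finite $K\subset S$ and an entourage $V$, a family $(x_s)_{s\in S}$ of points of $X$ is a $(K,V)$-pseudo-orbit if $(kx_s,x_{ks})\in V$ for all $k\in K$, $s\in S$. It is $U$-traced by the orbit of $x\in X$ if $(sx,x_s)\in U$ for all $s\in S$. The system has the pseudo-orbit tracing property if for every entourage $U$ of $X$ there exist a finite subset $K\subset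 S$ and an entourage $V$ of $X$ such that every $(K,V)$-pseudo-orbit is $U$-traced by the orbit of some point of $X$. $\mathrm{CSA}_S(X)$ is the set of all continuous semigroup actions of $S$ on $X$, with the topology of the uniform structure having as a base of entourages the sets $\{(\alpha,\beta): (\alpha_k(x),\beta_k(x))\in U \text{ for all } k\in K, x\in X\}$, where $K$ runs over finite subsets of $S$ and $U$ over entourages of $X$. $(X,S,\alpha)$ is topologically semistable if there is a neighborhood $N$ of $\alpha$ in $\mathrm{CSA}_S(X)$ such that for every $\beta\in N$ there is a continuous map $h\colon X\to X$ with $\alpha_s\circ h=h\circ\beta_s$ for all $s\in S$. *)

theory Defs
  imports "HOL-Analysis.Analysis"
begin

text \<open>
  Spaces are given by \<^typ>\<open>'x topology\<close>, so that points range over \<^term>\<open>topspace X\<close>; the values of a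
  map outside \<^term>\<open>topspace X\<close> are irrelevant, and all conditions below ignore them.
\<close>

definition neighbourhood_of_set :: "'a topology \<Rightarrow> 'a set \<Rightarrow> 'a set \<Rightarrow> bool" where
  "neighbourhood_of_set T A N \<longleftrightarrow>
     N \<subseteq> topspace T \<and> (\<exists>W. openin T W \<and> A \<subseteq> W \<and> W \<subseteq> N)"

text \<open>The unique compatible uniform structure when \<^term>\<open>X\<close> is compact Hausdorff.\<close>

definition entourage :: "'x topology \<Rightarrow> ('x \<times> 'x) set \<Rightarrow> bool" where
  "entourage X E \<longleftrightarrow> neighbourhood_of_set (prod_topology X X) {(x, x) | x. x \<in> topspace X} E"

definition continuous_action :: "'x topology \<Rightarrow> ('s::semigroup_mult \<Rightarrow> 'x \<Rightarrow> 'x) \<Rightarrow> bool" where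
  "continuous_action X \<alpha> \<longleftrightarrow>
     (\<forall>s. continuous_map X X (\<alpha> s)) \<and>
     (\<forall>s s'. \<forall>x\<in>topspace X. (\<alpha> s \<circ> \<alpha> s') x = \<alpha> (s * s') x)"

definition expansivity_entourage ::
    "'x topology \<Rightarrow> ('s::semigroup_mult \<Rightarrow> 'x \<Rightarrow> 'x) \<Rightarrow> ('x \<times> 'x) set \<Rightarrow> bool" where
  "expansivity_entourage X \<alpha> E \<longleftrightarrow>
     entourage X E \<and>
     (\<forall>x\<in>topspace X. \<forall>y\<in>topspace X. x \<noteq> y \<longrightarrow> (\<exists>s. (\<alpha> s x, \<alpha> s y) \<notin> E))"

definition expansive :: "'x topology \<Rightarrow> ('s::semigroup_mult \<Rightarrow> 'x \<Rightarrow> 'x) \<Rightarrow> bool" where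
  "expansive X \<alpha> \<longleftrightarrow> (\<exists>E. expansivity_entourage X \<alpha> E)"

definition pseudo_orbit ::
    "'x topology \<Rightarrow> ('s::semigroup_mult \<Rightarrow> 'x \<Rightarrow> 'x) \<Rightarrow> 's set \<Rightarrow> ('x \<times> 'x) set \<Rightarrow> ('s \<Rightarrow> 'x) \<Rightarrow> bool" where
  "pseudo_orbit X \<alpha> K V x \<longleftrightarrow>
     (\<forall>s. x s \<in> topspace X) \<and> (\<forall>k\<in>K. \<forall>s. (\<alpha> k (x s), x (k * s)) \<in> V)"

definition traced_by ::
    "('s::semigroup_mult \<Rightarrow> 'x \<Rightarrow> 'x) \<Rightarrow> ('x \<times> 'x) set \<Rightarrow> ('s \<Rightarrow> 'x) \<Rightarrow> 'x \<Rightarrow> bool" where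
  "traced_by \<alpha> U x p \<longleftrightarrow> (\<forall>s. (\<alpha> s p, x s) \<in> U)"

definition pseudo_orbit_tracing :: "'x topology \<Rightarrow> ('s::semigroup_mult \<Rightarrow> 'x \<Rightarrow> 'x) \<Rightarrow> bool" where
  "pseudo_orbit_tracing X \<alpha> \<longleftrightarrow>
     (\<forall>U. entourage X U \<longrightarrow>
        (\<exists>K V. finite K \<and> entourage X V \<and>
           (\<forall>x. pseudo_orbit X \<alpha> K V x \<longrightarrow> (\<exists>p\<in>topspace X. traced_by \<alpha> U x p))))"

definition CSA :: "'x topology \<Rightarrow> ('s::semigroup_mult \<Rightarrow> 'x \<Rightarrow> 'x) set" where
  "CSA X = {\<alpha>. continuous_action X \<alpha>}"

definition CSA_entourage ::
    "'x topology \<Rightarrow> 's::semigroup_mult set \<Rightarrow> ('x \<times> 'x) set \<Rightarrow> (('s \<Rightarrow> 'x \<Rightarrow> 'x) \<times> ('s \<Rightarrow> 'x \<Rightarrow> 'x)) set" where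
  "CSA_entourage X K U =
     {(\<alpha>, \<beta>) \<in> CSA X \<times> CSA X. \<forall>k\<in>K. \<forall>x\<in>topspace X. (\<alpha> k x, \<beta> k x) \<in> U}"

definition CSA_topology :: "'x topology \<Rightarrow> ('s::semigroup_mult \<Rightarrow> 'x \<Rightarrow> 'x) topology" where
  "CSA_topology X = topology (\<lambda>W. W \<subseteq> CSA X \<and>
     (\<forall>\<alpha>\<in>W. \<exists>K U. finite K \<and> entourage X U \<and> CSA_entourage X K U `` {\<alpha>} \<subseteq> W))"

definition topologically_semistable :: "'x topology \<Rightarrow> ('s::semigroup_mult \<Rightarrow> 'x \<Rightarrow> 'x) \<Rightarrow> bool" where
  "topologically_semistable X \<alpha> \<longleftrightarrow>
     (\<exists>N. neighbourhood_of_set (CSA_topology X) {\<alpha>} N \<and>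
        (\<forall>\<beta>\<in>N. \<exists>h. continuous_map X X h \<and>
           (\<forall>s. \<forall>x\<in>topspace X. (\<alpha> s \<circ> h) x = (h \<circ> \<beta> s) x)))"

lemma entourage_Int:
  assumes "entourage X U" "entourage X V"
  shows "entourage X (U \<inter> V)"
proof -
  obtain A where A: "openin (prod_topology X X) A" "{(x, x) | x. x \<in> topspace X} \<subseteq> A" "A \<subseteq> U"
    using assms(1) unfolding entourage_def neighbourhood_of_set_def by auto
  obtain B where B: "openin (prod_topology X X) B" "{(x, x) | x. x \<in> topspace X} \<subseteq> B" "B \<subseteq> V"
    using assms(2) unfolding entourage_def neighbourhood_of_set_def by auto
  have "U \<inter> V \<subseteq> topspace (prod_topology X X)"
    using assms(1) unfolding entourage_def neighbourhood_of_set_def by (simp add: le_infI1)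
  moreover have "openin (prod_topology X X) (A \<inter> B)"
    using A(1) B(1) by (rule openin_Int)
  moreover have "{(x, x) | x. x \<in> topspace X} \<subseteq> A \<inter> B"
    using A(2) B(2) by (rule Int_greatest)
  moreover have "A \<inter> B \<subseteq> U \<inter> V"
    using A(3) B(3) by (rule Int_mono)
  ultimately show ?thesis
    unfolding entourage_def neighbourhood_of_set_def by (intro conjI exI)
qed

lemma entourage_top: "entourage X (topspace X \<times> topspace X)"
  unfolding entourage_def neighbourhood_of_set_def
  by (auto intro!: exI[of _ "topspace X \<times> topspace X"] simp: openin_prod_Times_iff)

lemma openin_CSA_topology:
  fixes W :: "('s::semigroup_mult \<Rightarrow> 'x \<Rightarrow> 'x) set"
  shows "openin (CSA_topology X) W \<longleftrightarrow> W \<subseteq> CSA X \<and>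
     (\<forall>\<alpha>\<in>W. \<exists>K U. finite K \<and> entourage X U \<and> CSA_entourage X K U `` {\<alpha>} \<subseteq> W)"
proof -
  define Q where "Q W \<alpha> \<longleftrightarrow> (\<exists>K U. finite K \<and> entourage X U \<and> CSA_entourage X K U `` {\<alpha>} \<subseteq> W)"
    for W and \<alpha> :: "'s \<Rightarrow> 'x \<Rightarrow> 'x"
  define P where "P W \<longleftrightarrow> W \<subseteq> CSA X \<and> (\<forall>\<alpha>\<in>W. Q W \<alpha>)" for W
  have Q_mono: "Q B \<alpha>" if "Q A \<alpha>" "A \<subseteq> B" for A B \<alpha>
    using that unfolding Q_def by (meson order_trans)
  have Q_Int: "Q (A \<inter> B) \<alpha>" if A: "Q A \<alpha>" and B: "Q B \<alpha>" for A B \<alpha>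
  proof -
    obtain K U where 1: "finite K" "entourage X U" "CSA_entourage X K U `` {\<alpha>} \<subseteq> A"
      using A unfolding Q_def by auto
    obtain L V where 2: "finite L" "entourage X V" "CSA_entourage X L V `` {\<alpha>} \<subseteq> B"
      using B unfolding Q_def by auto
    have "CSA_entourage X (K \<union> L) (U \<inter> V) `` {\<alpha>} \<subseteq> CSA_entourage X K U `` {\<alpha>}"
      "CSA_entourage X (K \<union> L) (U \<inter> V) `` {\<alpha>} \<subseteq> CSA_entourage X L V `` {\<alpha>}"
      by (auto simp: CSA_entourage_def)
    then have "CSA_entourage X (K \<union> L) (U \<inter> V) `` {\<alpha>} \<subseteq> A \<inter> B"
      using 1(3) 2(3) by (meson Int_greatest order_trans)
    then show ?thesis
      unfolding Q_def using 1 2 entourage_Int[of X U V]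
      by (intro exI[of _ "K \<union> L"] exI[of _ "U \<inter> V"]) simp
  qed
  have "P (A \<inter> B)" if "P A" "P B" for A B
    using that Q_Int[of A _ B] unfolding P_def by auto
  moreover have "P (\<Union>\<W>)" if \<W>: "\<forall>A\<in>\<W>. P A" for \<W>
    unfolding P_def
  proof (intro conjI ballI)
    show "\<Union>\<W> \<subseteq> CSA X"
      using \<W> unfolding P_def by (intro Union_least) simp
    fix \<alpha> assume "\<alpha> \<in> \<Union>\<W>"
    then obtain A where A: "A \<in> \<W>" "\<alpha> \<in> A" ..
    then have "Q A \<alpha>"
      using \<W> unfolding P_def by simp
    then show "Q (\<Union>\<W>) \<alpha>"
      using A(1) by (rule Q_mono[OF _ Union_upper])
  qed
  ultimately have "istopology P"
    unfolding istopology_def by simp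
  moreover have "CSA_topology X = topology P"
    unfolding CSA_topology_def P_def Q_def ..
  ultimately show ?thesis
    by (simp add: topology_inverse' P_def Q_def)
qed

lemma topspace_CSA_topology:
  "topspace (CSA_topology X) = (CSA X :: ('b::semigroup_mult \<Rightarrow> 'a \<Rightarrow> 'a) set)"
proof
  show "topspace (CSA_topology X) \<subseteq> (CSA X :: ('b \<Rightarrow> 'a \<Rightarrow> 'a) set)"
    using openin_topspace[of "CSA_topology X"] unfolding openin_CSA_topology by (rule conjunct1)
  have "openin (CSA_topology X) (CSA X :: ('b \<Rightarrow> 'a \<Rightarrow> 'a) set)"
    unfolding openin_CSA_topology
  proof (intro conjI ballI)
    show "\<exists>K U. finite K \<and> entourage X U \<and> CSA_entourage X K U `` {\<alpha>} \<subseteq> CSA X"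
      for \<alpha> :: "'b \<Rightarrow> 'a \<Rightarrow> 'a"
      by (intro exI[of _ "{}"] exI[of _ "topspace X \<times> topspace X"])
        (auto simp: CSA_entourage_def entourage_top)
  qed simp
  then show "(CSA X :: ('b \<Rightarrow> 'a \<Rightarrow> 'a) set) \<subseteq> topspace (CSA_topology X)"
    by (rule openin_subset)
qed

end

theory Submission
  imports Defs
begin

text \<open>
  Close actions have close orbits: an orbit \<open>s \<mapsto> \<beta> s x\<close> of an action \<open>\<beta>\<close> near \<open>\<alpha>\<close> is a pseudo-orbit
  of \<open>\<alpha>\<close>, since \<open>\<beta> (k * s) x = \<beta> k (\<beta> s x)\<close> is close to \<open>\<alpha> k (\<beta> s x)\<close> for the finitely many \<open>k\<close>
  that matter. Hence the pseudo-orbit tracing property yields a point whose \<open>\<alpha>\<close>-orbit follows it,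
  and the map \<open>h\<close> sends \<open>x\<close> to such a point. The tracing precision \<open>U\<close> is chosen once and for all as a closed
  symmetric entourage with \<open>U O U \<subseteq> E\<close>, where \<open>E\<close> is an expansivity entourage of \<open>\<alpha>\<close>. Everything
  that has to be shown about \<open>h\<close> follows from this choice.

  Two points that trace the same family have \<open>E\<close>-close \<open>\<alpha>\<close>-orbits, so they coincide
  (\<open>tracing_point_unique\<close>). Uniqueness gives equivariance, because \<open>\<alpha> t (h x)\<close> traces the
  \<open>\<beta>\<close>-orbit of \<open>\<beta> t x\<close>. It also says that the graph of \<open>h\<close> is the set of all pairs \<open>(x, p)\<close> with
  \<open>(\<alpha> s p, \<beta> s x) \<in> U\<close> for all \<open>s\<close>. This set is closed as \<open>U\<close> is closed, and a map into a compact
  space with a closed graph is continuous (\<open>tracing_map_continuous\<close>). The same triangle argument with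
  the roles exchanged shows that \<open>h x = h y\<close> forces \<open>x\<close> and \<open>y\<close> to have \<open>E\<close>-close \<open>\<beta>\<close>-orbits, so
  \<open>h\<close> is injective as soon as \<open>\<beta>\<close> is \<open>E\<close>-expansive.

  The two halves of the theorem are thus about one and the same map (\<open>semiconjugacy_near_action\<close>).
\<close>

section \<open>Entourages of a compact Hausdorff space\<close>

lemma entourage_refl:
  assumes "entourage X E" "x \<in> topspace X"
  shows "(x, x) \<in> E"
  using assms unfolding entourage_def neighbourhood_of_set_def by blast

text \<open>
  Both the tracing precision and the topology on actions rest on halving entourages.
  Every point lies in a set \<open>D\<close> with \<open>D \<times> D \<subseteq> E\<close>, and finitely many interiors of such sets still
  cover the space after being shrunk to sets \<open>P\<close>. Then \<open>U\<close> consists of the pairs which, for each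
  of these \<open>P \<subseteq> D\<close>, have both entries in \<open>D\<close> or both outside \<open>P\<close>. If \<open>(a, b)\<close> and \<open>(b, c)\<close> are such
  pairs and \<open>b\<close> lies in \<open>P\<close>, then both \<open>a\<close> and \<open>c\<close> are in \<open>D\<close>.
\<close>

lemma closed_symmetric_half_entourage:
  assumes comp: "compact_space X" and haus: "Hausdorff_space X" and E: "entourage X E"
  obtains U where "entourage X U" "closedin (prod_topology X X) U" "sym U" "U O U \<subseteq> E"
proof -
  obtain A where A: "openin (prod_topology X X) A" "{(x, x) | x. x \<in> topspace X} \<subseteq> A" "A \<subseteq> E"
    using E unfolding entourage_def neighbourhood_of_set_def by auto
  have nb: "\<exists>U V. openin X U \<and> closedin X V \<and> x \<in> U \<and> U \<subseteq> V \<and> V \<subseteq> W"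
    if "openin X W" "x \<in> W" for W x
    using compact_Hausdorff_imp_regular_space[OF comp haus] that
    unfolding neighbourhood_base_of_closedin[symmetric] neighbourhood_base_of by blast
  define nested where "nested x P C O' D \<longleftrightarrow>
      openin X P \<and> closedin X C \<and> openin X O' \<and> closedin X D \<and>
      x \<in> P \<and> P \<subseteq> C \<and> C \<subseteq> O' \<and> O' \<subseteq> D \<and> D \<times> D \<subseteq> E" for x P C O' D
  have "\<exists>P C O' D. nested x P C O' D" if x: "x \<in> topspace X" for x
  proof -
    have "(x, x) \<in> A"
      using A(2) x by auto
    then obtain G H where GH: "openin X G" "openin X H" "x \<in> G" "x \<in> H" "G \<times> H \<subseteq> A"
      using A(1) unfolding openin_prod_topology_alt by meson
    then have "openin X (G \<inter> H)" "x \<in> G \<inter> H"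
      by auto
    from nb[OF this] obtain O' D
      where OD: "openin X O'" "closedin X D" "x \<in> O'" "O' \<subseteq> D" "D \<subseteq> G \<inter> H"
      by auto
    from nb[OF OD(1,3)] obtain P C
      where "openin X P" "closedin X C" "x \<in> P" "P \<subseteq> C" "C \<subseteq> O'"
      by auto
    moreover have "D \<times> D \<subseteq> E"
      using OD(5) GH(5) A(3) by blast
    ultimately show ?thesis
      unfolding nested_def using OD(1,2,4) by blast
  qed
  then obtain P C O' D where "nested x (P x) (C x) (O' x) (D x)" if "x \<in> topspace X" for x
    by metis
  then have shrink: "openin X (P x)" "closedin X (C x)" "openin X (O' x)"
      "closedin X (D x)" "x \<in> P x" "P x \<subseteq> C x" "C x \<subseteq> O' x" "O' x \<subseteq> D x" "D x \<times> D x \<subseteq> E"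
    if "x \<in> topspace X" for x
    using that unfolding nested_def by auto
  have "\<forall>U\<in>P ` topspace X. openin X U" "topspace X \<subseteq> \<Union>(P ` topspace X)"
    using shrink(1,5) by auto
  then obtain F where F: "finite F" "F \<subseteq> topspace X" "topspace X \<subseteq> \<Union>(P ` F)"
    using comp unfolding compact_space_alt by (metis finite_subset_image)
  let ?T = "topspace X"
  \<comment> \<open>Intersecting with the whole product covers the empty space, where \<open>F\<close> is empty.\<close>
  define U where "U = (?T \<times> ?T) \<inter> (\<Inter>x\<in>F. D x \<times> D x \<union> (?T - P x) \<times> (?T - P x))"
  \<comment> \<open>The analogous set built from the open \<open>O' x\<close> and the closed \<open>C x\<close> witnesses that \<open>U\<close> is a
      neighbourhood of the diagonal.\<close>
  define V where "V = (?T \<times> ?T) \<inter> (\<Inter>x\<in>F. O' x \<times> O' x \<union> (?T - C x) \<times> (?T - C x))"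
  have "openin (prod_topology X X) (O' x \<times> O' x \<union> (?T - C x) \<times> (?T - C x))"
    if "x \<in> F" for x
    using shrink(2,3)[of x] that F(2)
    by (intro openin_Un) (auto simp: openin_prod_Times_iff openin_diff)
  then have V_open: "openin (prod_topology X X) V"
    unfolding V_def by (cases "F = {}") (auto simp: F(1) openin_prod_Times_iff intro!: openin_Int)
  have diag_V: "{(x, x) | x. x \<in> ?T} \<subseteq> V"
    unfolding V_def using shrink(7) F(2) by fastforce
  have "V \<subseteq> U"
    unfolding V_def U_def using shrink(6,8) F(2) by fastforce
  moreover have "U \<subseteq> ?T \<times> ?T"
    unfolding U_def by blast
  ultimately have "entourage X U"
    unfolding entourage_def neighbourhood_of_set_def using V_open diag_V by auto
  moreover have "closedin (prod_topology X X) (D x \<times> D x \<union> (?T - P x) \<times> (?T - P x))"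
    if "x \<in> F" for x
    using shrink(1,4)[of x] that F(2)
    by (intro closedin_Un) (auto simp: closedin_prod_Times_iff)
  then have "closedin (prod_topology X X) U"
    unfolding U_def
    by (cases "F = {}") (auto simp: closedin_prod_Times_iff intro!: closedin_Int closedin_INT)
  moreover have "sym U"
    unfolding U_def sym_def by auto
  moreover have "U O U \<subseteq> E"
  proof
    fix q assume "q \<in> U O U"
    then obtain a b c where q: "q = (a, c)" and ab: "(a, b) \<in> U" and bc: "(b, c) \<in> U"
      by auto
    have "b \<in> ?T"
      using ab unfolding U_def by blast
    then obtain x where x: "x \<in> F" "b \<in> P x"
      using F(3) by blast
    then have "a \<in> D x" "c \<in> D x"
      using ab bc unfolding U_def by auto
    then show "q \<in> E"
      using shrink(9)[of x] x(1) F(2) q by auto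
  qed
  ultimately show thesis
    by (rule that)
qed

section \<open>Neighbourhoods in the space of actions\<close>

text \<open>
  The topology on actions declares a set to be open when it contains a basic ball around each of its
  members, so a ball need not be open itself. It contains the set of all members that have a ball
  inside it, and this set is open because entourages can be halved.
\<close>

lemma neighbourhood_CSA_ball:
  fixes \<alpha> :: "'s::semigroup_mult \<Rightarrow> 'x \<Rightarrow> 'x"
  assumes comp: "compact_space X" and haus: "Hausdorff_space X"
    and \<alpha>: "continuous_action X \<alpha>" and K: "finite K" and V: "entourage X V"
  shows "neighbourhood_of_set (CSA_topology X) {\<alpha>} (CSA_entourage X K V `` {\<alpha>})"
proof -
  let ?N = "CSA_entourage X K V `` {\<alpha>}"
  define W where "W = {\<beta> \<in> CSA X. \<exists>L U. finite L \<and> entourage X U \<and> CSA_entourage X L U `` {\<beta>} \<subseteq> ?N}"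
  have "openin (CSA_topology X) W"
    unfolding openin_CSA_topology
  proof (intro conjI ballI)
    show "W \<subseteq> CSA X"
      unfolding W_def by blast
    fix \<beta> assume "\<beta> \<in> W"
    then obtain L U where \<beta>: "\<beta> \<in> CSA X" and L: "finite L" and U: "entourage X U"
      and sub: "CSA_entourage X L U `` {\<beta>} \<subseteq> ?N"
      unfolding W_def by blast
    obtain U' where U': "entourage X U'" "U' O U' \<subseteq> U"
      using closed_symmetric_half_entourage[OF comp haus U] by metis
    have "CSA_entourage X L U' `` {\<beta>} \<subseteq> W"
    proof
      fix \<gamma> assume \<gamma>: "\<gamma> \<in> CSA_entourage X L U' `` {\<beta>}"
      have "CSA_entourage X L U' `` {\<gamma>} \<subseteq> CSA_entourage X L U `` {\<beta>}"
        using \<gamma> U'(2) unfolding CSA_entourage_def by blast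
      then have "CSA_entourage X L U' `` {\<gamma>} \<subseteq> ?N"
        using sub by (rule order_trans)
      moreover have "\<gamma> \<in> CSA X"
        using \<gamma> by (auto simp: CSA_entourage_def)
      ultimately show "\<gamma> \<in> W"
        unfolding W_def using L U'(1) by blast
    qed
    then show "\<exists>L U. finite L \<and> entourage X U \<and> CSA_entourage X L U `` {\<beta>} \<subseteq> W"
      using L U'(1) by blast
  qed
  moreover have "{\<alpha>} \<subseteq> W"
    unfolding W_def using \<alpha> K V by (auto simp: CSA_def)
  moreover have "\<beta> \<in> ?N" if mem: "\<beta> \<in> W" for \<beta>
  proof -
    obtain L U where \<beta>: "\<beta> \<in> CSA X" and U: "entourage X U"
      and sub: "CSA_entourage X L U `` {\<beta>} \<subseteq> ?N"
      using mem unfolding W_def by blast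
    have "\<beta> l x \<in> topspace X" if "x \<in> topspace X" for l x
      using \<beta> that unfolding CSA_def continuous_action_def continuous_map_def by blast
    then have "\<beta> \<in> CSA_entourage X L U `` {\<beta>}"
      using \<beta> entourage_refl[OF U] by (auto simp: CSA_entourage_def)
    then show ?thesis
      using sub by blast
  qed
  moreover have "?N \<subseteq> topspace (CSA_topology X)"
    unfolding topspace_CSA_topology CSA_entourage_def by blast
  ultimately show ?thesis
    unfolding neighbourhood_of_set_def by blast
qed

section \<open>Orbits and tracing points\<close>

lemma continuous_action_in_topspace:
  assumes "continuous_action X \<alpha>" "x \<in> topspace X"
  shows "\<alpha> s x \<in> topspace X"
  using assms unfolding continuous_action_def continuous_map_def by blast

lemma continuous_action_mult:
  assumes "continuous_action X \<alpha>" "x \<in> topspace X"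
  shows "\<alpha> (s * t) x = \<alpha> s (\<alpha> t x)"
  using assms unfolding continuous_action_def by simp

lemma orbit_of_nearby_action_is_pseudo_orbit:
  assumes \<beta>: "\<beta> \<in> CSA_entourage X K V `` {\<alpha>}" and x: "x \<in> topspace X"
  shows "pseudo_orbit X \<alpha> K V (\<lambda>s. \<beta> s x)"
proof -
  have act: "continuous_action X \<beta>"
    using \<beta> by (auto simp: CSA_entourage_def CSA_def)
  show ?thesis
    unfolding pseudo_orbit_def continuous_action_mult[OF act x]
    using \<beta> continuous_action_in_topspace[OF act x] by (auto simp: CSA_entourage_def)
qed

lemma expansivity_entourage_unique:
  assumes "expansivity_entourage X \<alpha> E" "p \<in> topspace X" "q \<in> topspace X"
    and "\<And>s. (\<alpha> s p, \<alpha> s q) \<in> E"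
  shows "p = q"
  using assms unfolding expansivity_entourage_def by blast

lemma tracing_point_unique:
  assumes "expansivity_entourage X \<alpha> E" "sym U" "U O U \<subseteq> E"
    and "p \<in> topspace X" "q \<in> topspace X" "traced_by \<alpha> U x p" "traced_by \<alpha> U x q"
  shows "p = q"
proof (rule expansivity_entourage_unique[OF assms(1,4,5)])
  fix s
  have "(\<alpha> s p, x s) \<in> U" "(x s, \<alpha> s q) \<in> U"
    using assms(6,7) symD[OF assms(2)] unfolding traced_by_def by auto
  then show "(\<alpha> s p, \<alpha> s q) \<in> E"
    using assms(3) by blast
qed

lemma traced_orbit_shift:
  assumes "continuous_action X \<alpha>" "continuous_action X \<beta>" "p \<in> topspace X" "x \<in> topspace X"
    and "traced_by \<alpha> U (\<lambda>s. \<beta> s x) p"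
  shows "traced_by \<alpha> U (\<lambda>s. \<beta> s (\<beta> t x)) (\<alpha> t p)"
  using assms(5) unfolding traced_by_def
  by (simp flip: continuous_action_mult[OF assms(1,3)] continuous_action_mult[OF assms(2,4)])

text \<open>
  The preimage of a closed set \<open>C\<close> under \<open>h\<close> is the first projection of the part of the
  graph with second coordinate in \<open>C\<close>, and projecting along a compact factor preserves closed sets.
\<close>

lemma closed_graph_imp_continuous_map:
  assumes comp: "compact_space Y" and h: "h \<in> topspace X \<rightarrow> topspace Y"
    and graph: "closedin (prod_topology X Y) ((\<lambda>x. (x, h x)) ` topspace X)"
  shows "continuous_map X Y h"
  unfolding continuous_map_closedin
proof (intro conjI allI impI h)
  fix C assume C: "closedin Y C"
  let ?R = "(\<lambda>x. (x, h x)) ` topspace X \<inter> topspace X \<times> C"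
  have "closedin (prod_topology X Y) ?R"
    using graph C by (auto simp: closedin_prod_Times_iff intro!: closedin_Int)
  then have "closedin X (fst ` ?R)"
    using Abstract_Topological_Spaces.closed_map_fst[OF comp] unfolding closed_map_def by blast
  moreover have "fst ` ?R = {x \<in> topspace X. h x \<in> C}"
    by force
  ultimately show "closedin X {x \<in> topspace X. h x \<in> C}"
    by simp
qed

text \<open>
  Where tracing points are unique, the graph of \<open>h\<close> is cut out by the tracing
  conditions alone, and each of these is closed.
\<close>

lemma tracing_map_continuous:
  assumes comp: "compact_space X" and \<alpha>: "continuous_action X \<alpha>" and \<beta>: "continuous_action X \<beta>"
    and U: "closedin (prod_topology X X) U"
    and h: "\<And>x. x \<in> topspace X \<Longrightarrow> h x \<in> topspace X \<and> traced_by \<alpha> U (\<lambda>s. \<beta> s x) (h x)"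
    and unique: "\<And>x p. x \<in> topspace X \<Longrightarrow> p \<in> topspace X \<Longrightarrow> traced_by \<alpha> U (\<lambda>s. \<beta> s x) p \<Longrightarrow> p = h x"
  shows "continuous_map X X h"
proof (rule closed_graph_imp_continuous_map[OF comp])
  show "h \<in> topspace X \<rightarrow> topspace X"
    using h by blast
  let ?Z = "prod_topology X X"
  let ?R = "\<lambda>s. {z \<in> topspace ?Z. (\<alpha> s (snd z), \<beta> s (fst z)) \<in> U}"
  have "continuous_map ?Z ?Z (\<lambda>z. (\<alpha> s (snd z), \<beta> s (fst z)))" for s
  proof -
    have "continuous_map X X (\<alpha> s)" "continuous_map X X (\<beta> s)"
      using \<alpha> \<beta> unfolding continuous_action_def by auto
    then have "continuous_map ?Z X (\<alpha> s \<circ> snd)" "continuous_map ?Z X (\<beta> s \<circ> fst)"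
      by (auto intro: continuous_map_compose continuous_map_fst continuous_map_snd)
    then show ?thesis
      by (auto simp: o_def intro: continuous_map_pairedI)
  qed
  then have "closedin ?Z (\<Inter>s. ?R s)"
    by (intro closedin_INT closedin_continuous_map_preimage[OF _ U]) auto
  moreover have "(\<Inter>s. ?R s) = (\<lambda>x. (x, h x)) ` topspace X"
  proof (intro equalityI subsetI)
    fix z assume "z \<in> (\<Inter>s. ?R s)"
    then have z: "fst z \<in> topspace X" "snd z \<in> topspace X" "traced_by \<alpha> U (\<lambda>s. \<beta> s (fst z)) (snd z)"
      unfolding traced_by_def by auto
    from unique[OF this] have "z = (fst z, h (fst z))"
      by (metis prod.collapse)
    with z(1) show "z \<in> (\<lambda>x. (x, h x)) ` topspace X"
      by blast
  next
    fix z assume "z \<in> (\<lambda>x. (x, h x)) ` topspace X"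
    then show "z \<in> (\<Inter>s. ?R s)"
      using h unfolding traced_by_def by auto
  qed
  ultimately show "closedin ?Z ((\<lambda>x. (x, h x)) ` topspace X)"
    by simp
qed

section \<open>Semistability\<close>

text \<open>
  The neighbourhood is the ball given by the \<open>K\<close> and \<open>V\<close> that the tracing property provides for the
  half \<open>U\<close> of \<open>E\<close>. It is fixed before \<open>\<beta>\<close> is chosen, and injectivity is kept as an implication, so that
  the same neighbourhood serves both claims of the theorem.
\<close>

lemma semiconjugacy_near_action:
  fixes X :: "'x topology" and \<alpha> :: "'s::semigroup_mult \<Rightarrow> 'x \<Rightarrow> 'x"
  assumes comp: "compact_space X" and haus: "Hausdorff_space X"
    and \<alpha>: "continuous_action X \<alpha>" and E: "expansivity_entourage X \<alpha> E"
    and tracing: "pseudo_orbit_tracing X \<alpha>"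
  obtains N where "neighbourhood_of_set (CSA_topology X) {\<alpha>} N"
    and "\<And>\<beta>. \<beta> \<in> N \<Longrightarrow> \<exists>h. continuous_map X X h \<and>
      (\<forall>s. \<forall>x\<in>topspace X. (\<alpha> s \<circ> h) x = (h \<circ> \<beta> s) x) \<and>
      (expansivity_entourage X \<beta> E \<longrightarrow> inj_on h (topspace X))"
proof -
  obtain U where U: "entourage X U" "closedin (prod_topology X X) U" "sym U" "U O U \<subseteq> E"
    using closed_symmetric_half_entourage[OF comp haus] E unfolding expansivity_entourage_def by metis
  obtain K V where K: "finite K" and V: "entourage X V"
    and trace: "\<And>x. pseudo_orbit X \<alpha> K V x \<Longrightarrow> \<exists>p\<in>topspace X. traced_by \<alpha> U x p"
    using tracing U(1) unfolding pseudo_orbit_tracing_def by meson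
  show thesis
  proof (rule that[OF neighbourhood_CSA_ball[OF comp haus \<alpha> K V]])
    fix \<beta> assume near: "\<beta> \<in> CSA_entourage X K V `` {\<alpha>}"
    then have \<beta>: "continuous_action X \<beta>"
      by (auto simp: CSA_entourage_def CSA_def)
    have "\<forall>x\<in>topspace X. \<exists>p. p \<in> topspace X \<and> traced_by \<alpha> U (\<lambda>s. \<beta> s x) p"
      using trace[OF orbit_of_nearby_action_is_pseudo_orbit[OF near]] by blast
    from bchoice[OF this] obtain h
      where "\<forall>x\<in>topspace X. h x \<in> topspace X \<and> traced_by \<alpha> U (\<lambda>s. \<beta> s x) (h x)" ..
    then have h: "h x \<in> topspace X" "traced_by \<alpha> U (\<lambda>s. \<beta> s x) (h x)" if "x \<in> topspace X" for x
      using that by auto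
    have unique: "p = h x" if "x \<in> topspace X" "p \<in> topspace X" "traced_by \<alpha> U (\<lambda>s. \<beta> s x) p" for x p
      using tracing_point_unique[OF E U(3,4) that(2) h(1)[OF that(1)] that(3) h(2)[OF that(1)]] .
    have "continuous_map X X h"
      by (rule tracing_map_continuous[OF comp \<alpha> \<beta> U(2)]) (simp_all add: h unique)
    moreover have "\<alpha> t (h x) = h (\<beta> t x)" if x: "x \<in> topspace X" for t x
      using h[OF x] x
      by (intro unique traced_orbit_shift[OF \<alpha> \<beta>] continuous_action_in_topspace[OF \<alpha>]
          continuous_action_in_topspace[OF \<beta>])
    moreover have "inj_on h (topspace X)" if E': "expansivity_entourage X \<beta> E"
    proof (rule inj_onI)
      fix x y assume x: "x \<in> topspace X" and y: "y \<in> topspace X" and eq: "h x = h y"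
      show "x = y"
      proof (rule expansivity_entourage_unique[OF E' x y])
        fix s
        have "(\<beta> s x, \<alpha> s (h x)) \<in> U" "(\<alpha> s (h x), \<beta> s y) \<in> U"
          using h(2)[OF x] h(2)[OF y] eq symD[OF U(3)] unfolding traced_by_def by auto
        then show "(\<beta> s x, \<beta> s y) \<in> E"
          using U(4) by blast
      qed
    qed
    ultimately show "\<exists>h. continuous_map X X h \<and>
        (\<forall>s. \<forall>x\<in>topspace X. (\<alpha> s \<circ> h) x = (h \<circ> \<beta> s) x) \<and>
        (expansivity_entourage X \<beta> E \<longrightarrow> inj_on h (topspace X))"
      by (intro exI[of _ h]) auto
  qed
qed

theorem theorem3p4:
  fixes X :: "'x topology" and \<alpha> :: "'s::semigroup_mult \<Rightarrow> 'x \<Rightarrow> 'x"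
  assumes "compact_space X" and "Hausdorff_space X"
    and "continuous_action X \<alpha>"
    and "expansive X \<alpha>"
    and "pseudo_orbit_tracing X \<alpha>"
  shows "topologically_semistable X \<alpha> \<and>
    (\<forall>E. expansivity_entourage X \<alpha> E \<longrightarrow>
      (\<exists>N. neighbourhood_of_set (CSA_topology X) {\<alpha>} N \<and>
        (\<forall>\<beta>\<in>N. expansivity_entourage X \<beta> E \<longrightarrow>
          (\<exists>h. continuous_map X X h \<and> inj_on h (topspace X) \<and>
            (\<forall>s. \<forall>x\<in>topspace X. (\<alpha> s \<circ> h) x = (h \<circ> \<beta> s) x)))))"
proof (intro conjI allI impI)
  obtain E where E: "expansivity_entourage X \<alpha> E"
    using assms(4) unfolding expansive_def ..
  show "topologically_semistable X \<alpha>"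
    by (rule semiconjugacy_near_action[OF assms(1-3) E assms(5)])
      (unfold topologically_semistable_def, meson)
next
  fix E assume E: "expansivity_entourage X \<alpha> E"
  show "\<exists>N. neighbourhood_of_set (CSA_topology X) {\<alpha>} N \<and>
      (\<forall>\<beta>\<in>N. expansivity_entourage X \<beta> E \<longrightarrow>
        (\<exists>h. continuous_map X X h \<and> inj_on h (topspace X) \<and>
          (\<forall>s. \<forall>x\<in>topspace X. (\<alpha> s \<circ> h) x = (h \<circ> \<beta> s) x)))"
    by (rule semiconjugacy_near_action[OF assms(1-3) E assms(5)]) meson
qed

end
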